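(* (a) For $n\ge 1$, $|U_n| = a_n$, where $(a_n)$ is the OEIS sequence A028495, and $a_n$ is the number of $01$-words in $X_n$. For $n=1,\dots,10$ the values of $|U_n|$ are $1,2,3,6,10,19,33,61,108,197$. (b) For $n\ge 2$, the number of two-row tableaux in $U_n$, which is $|U_n|-1$, equals $b_{n-2}$, where $(b_m)_{m\ge0}$ is the OEIS sequence A077865, and it is the number of $01$-words in $X_n$ other than the all-$0$s word. (c) For $n\ge1$, the number of tableaux in $U_n$ having $n$ in the second row equals $c_n$, where $(c_n)$ is the OEIS sequence A006053, and it is the number of $01$-words in $X_n$ that start with the letter $1$. For $n=1,\dots,10$ the values are $0,1,1,3,4,9,14,28,47,89$.
   Context: A set $L$ of integers is uncrowded if $|[y,y+2x]\cap L|\le x+1$ for all integers $x,y$ with $x>0$. A standard Young tableau with at most two rows is uncrowded if the set of entries in its second row is uncrowded (in particular, a one-row tableau is uncrowded). $U_n$ is the set of uncrowded standard Young tableaux of size $n$ (with at most two rows, filled with $1,\dots,n$). $X_n$ is the set of words of length $n-1$ in the letters $0,1$ in which every maximal block of consecutive $1$s has odd length. OEIS sequences: A028495 is $(a_n)_{n\ge0}$ with $a_0=1,\ a_1=1,\ a_2=2$ and $a_n=a_{n-1}+2a_{n-2}-a_{n-3}$ for $n\ge3$. A006053 is $(c_n)_{n\ge0}$ with $c_0=0,\ c_1=0,\ c_2=1$ and $c_n=c_{n-1}+2c_{n-2}-c_{n-3}$ for $n\ge3$. A077865 is $(b_m)_{m\ge0}$ with generating function $\sum_{m\ge0}b_mx^m=\dfrac{1}{(1-x)(1-x-2x^2+x^3)}$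 (so $1,2,5,9,18,32,\dots$). *)

theory Defs
  imports Complex_Main "HOL-Computational_Algebra.Formal_Power_Series"
begin

definition uncrowded :: "int set \<Rightarrow> bool" where
  "uncrowded L \<longleftrightarrow> (\<forall>x y::int. x > 0 \<longrightarrow> int (card ({y..y + 2 * x} \<inter> L)) \<le> x + 1)"

(* A tableau is the list of its (nonempty) rows, the first row being the longest. *)
definition standard_young_tableau :: "nat \<Rightarrow> nat list list \<Rightarrow> bool" where
  "standard_young_tableau n T \<longleftrightarrow>
     (\<forall>r\<in>set T. r \<noteq> []) \<and>
     sorted_wrt (\<ge>) (map length T) \<and>
     (\<forall>r\<in>set T. sorted_wrt (<) r) \<and>
     (\<forall>i j. Suc i < length T \<and> j < length (T ! Suc i) \<longrightarrow> T ! i ! j < T ! Suc i ! j) \<and>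
     distinct (concat T) \<and>
     set (concat T) = {1..n}"

(* Entries of the second row; the empty set if there is no second row. *)
definition second_row :: "nat list list \<Rightarrow> nat set" where
  "second_row T = (if length T \<ge> 2 then set (T ! 1) else {})"

definition U :: "nat \<Rightarrow> nat list list set" where
  "U n = {T. standard_young_tableau n T \<and> length T \<le> 2 \<and> uncrowded (int ` second_row T)}"

(* The premises on u and v say that the block of k ones cannot be extended. *)
definition odd_one_blocks :: "nat list \<Rightarrow> bool" where
  "odd_one_blocks w \<longleftrightarrow>
     (\<forall>u k v. w = u @ replicate k 1 @ v \<and> k > 0 \<and>
        (u = [] \<or> last u \<noteq> 1) \<and> (v = [] \<or> hd v \<noteq> 1) \<longrightarrow> odd k)"

definition X :: "nat \<Rightarrow> nat list set" where
  "X n = {w. set w \<subseteq> {0, 1} \<and> length w = n - 1 \<and> odd_one_blocks w}"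

fun A028495 :: "nat \<Rightarrow> int" where
  "A028495 0 = 1"
| "A028495 (Suc 0) = 1"
| "A028495 (Suc (Suc 0)) = 2"
| "A028495 (Suc (Suc (Suc n))) =
     A028495 (Suc (Suc n)) + 2 * A028495 (Suc n) - A028495 n"

fun A006053 :: "nat \<Rightarrow> int" where
  "A006053 0 = 0"
| "A006053 (Suc 0) = 0"
| "A006053 (Suc (Suc 0)) = 1"
| "A006053 (Suc (Suc (Suc n))) =
     A006053 (Suc (Suc n)) + 2 * A006053 (Suc n) - A006053 n"

(* Rational coefficients, so that the quotient is that of formal power series over a field. *)
definition A077865 :: "nat \<Rightarrow> rat" where
  "A077865 m = fps_nth
     (1 / ((1 - fps_X) * (1 - fps_X - 2 * fps_X ^ 2 + fps_X ^ 3))) m"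

end

theory Submission
  imports Defs
begin

text \<open>
  A tableau with at most two rows is determined by its second row \<open>L\<close>, and a subset \<open>L\<close> of
  \<open>{1..n}\<close> occurs as a second row exactly when it satisfies the ballot condition: no initial
  segment of \<open>{1..n}\<close> has more than half of its elements in \<open>L\<close>. Read \<open>L\<close> as a lattice path that
  goes up at the elements of \<open>L\<close> and down elsewhere. The ballot condition says that the path stays
  at height at most 0, and \<open>L\<close> is uncrowded exactly when the path never climbs by more than 2
  between two of its points (\<open>uncrowded_iff_height\<close>).

  Both conditions bound the next up-steps from above, and only the tighter bound matters. Let the
  room at a point be the number of consecutive up-steps that both conditions still permit. The
  room starts at 0, an up-step lowers it by 1, and a down-step raises it by 1, but never above 2.
  So the admissible sets are the walks of length \<open>n\<close> from the endpoint 0 of the path 0 -- 1 -- 2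
  with a loop at 2 (\<open>admissible_eq\<close>). Counting these walks by their final state gives linear
  recurrences, solved by differences of terms of \<open>A006053\<close>. The walks that end with a down-step are
  in bijection with all walks of length \<open>n - 1\<close>, since a down-step is never blocked; hence the
  number of all walks is 1 plus a partial sum of \<open>A006053\<close>, which is \<open>A028495\<close>.

  On the side of words, splitting off a first letter 0 or a first pair 10 or 11 leads to
  recurrences that the same two sequences satisfy. The removal of the empty second row,
  respectively of the word without 1s, subtracts 1 from \<open>A028495\<close>; the generating function of the result is that of \<open>A077865\<close>.
\<close>

section \<open>Second rows as ballot sets\<close>

text \<open>The height after \<open>m\<close> steps of the path with up-steps at \<open>L\<close> and down-steps elsewhere.\<close>

definition height :: "nat set \<Rightarrow> nat \<Rightarrow> int" where
  "height L m = 2 * int (card (L \<inter> {1..m})) - int m"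

lemma height_0 [simp]: "height L 0 = 0"
  by (simp add: height_def)

lemma height_Suc: "height L (Suc m) = (if Suc m \<in> L then height L m + 1 else height L m - 1)"
proof -
  have "{1..Suc m} = insert (Suc m) {1..m}" by auto
  then show ?thesis by (simp add: height_def)
qed

lemma height_diff:
  assumes "i \<le> j"
  shows "height L j - height L i = 2 * int (card (L \<inter> {i<..j})) - int (j - i)"
proof -
  have "L \<inter> {1..j} = (L \<inter> {1..i}) \<union> (L \<inter> {i<..j})" using assms by auto
  then have "card (L \<inter> {1..j}) = card (L \<inter> {1..i}) + card (L \<inter> {i<..j})"
    using card_Un_disjoint[of "L \<inter> {1..i}" "L \<inter> {i<..j}"] by force
  then show ?thesis using assms by (simp add: height_def)
qed

definition ballot :: "nat \<Rightarrow> nat set \<Rightarrow> bool" where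
  "ballot n L \<longleftrightarrow> (\<forall>m\<le>n. height L m \<le> 0)"

text \<open>Converts between an entry of an increasing row and the number of entries up to a bound. It
  carries the comparison of columns over to a comparison of cardinalities.\<close>

lemma nth_le_iff_less_card:
  fixes xs :: "nat list"
  assumes "sorted_wrt (<) xs" "i < length xs"
  shows "xs ! i \<le> m \<longleftrightarrow> i < card (set xs \<inter> {..m})"
  using assms
proof (induction xs arbitrary: i)
  case Nil
  then show ?case by simp
next
  case (Cons x xs)
  show ?case
  proof (cases "x \<le> m")
    case True
    have "x \<notin> set xs" using Cons.prems(1) by auto
    then have "card (set (x # xs) \<inter> {..m}) = Suc (card (set xs \<inter> {..m}))"
      using True by simp
    then show ?thesis using Cons True by (cases i) auto
  next
    case False
    then have "set (x # xs) \<inter> {..m} = {}" using Cons.prems(1) by force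
    moreover have "\<not> (x # xs) ! i \<le> m"
    proof -
      have "(x # xs) ! i \<in> set (x # xs)" using Cons.prems(2) nth_mem by blast
      then show ?thesis using False Cons.prems(1) by force
    qed
    ultimately show ?thesis by simp
  qed
qed

text \<open>Column \<open>j\<close> increases exactly when, up to the \<open>j\<close>-th entry \<open>m\<close> of the second row, the first row has
  more than \<open>j\<close> entries. So all columns increase when at every \<open>m\<close> the first row is at least as
  well represented among \<open>1, \<dots>, m\<close> as the second. The comparison of the lengths is the case
  \<open>m = n\<close>.\<close>

lemma columns_increase_iff_ballot:
  assumes a: "sorted_wrt (<) a" and b: "sorted_wrt (<) b"
    and disj: "set a \<inter> set b = {}" and un: "set a \<union> set b = {1..n}"
  shows "length b \<le> length a \<and> (\<forall>j<length b. a ! j < b ! j) \<longleftrightarrow> ballot n (set b)"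
proof -
  define ca cb where "ca m = card (set a \<inter> {..m})" and "cb m = card (set b \<inter> {..m})" for m
  have sum: "ca m + cb m = m" if "m \<le> n" for m
  proof -
    have "(set a \<inter> {..m}) \<union> (set b \<inter> {..m}) = (set a \<union> set b) \<inter> {..m}" by blast
    also have "\<dots> = {1..m}" unfolding un using that by auto
    finally have "(set a \<inter> {..m}) \<union> (set b \<inter> {..m}) = {1..m}" .
    moreover have "card ((set a \<inter> {..m}) \<union> (set b \<inter> {..m})) = ca m + cb m"
      unfolding ca_def cb_def using disj by (intro card_Un_disjoint) auto
    ultimately show ?thesis by simp
  qed
  have "set b \<inter> {1..m} = set b \<inter> {..m}" for m using un by auto
  then have h: "height (set b) m \<le> 0 \<longleftrightarrow> cb m \<le> ca m" if "m \<le> n" for m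
    using sum[OF that] by (auto simp: height_def cb_def)
  have an: "ca n = length a" and bn: "cb n = length b"
  proof -
    have "set a \<inter> {..n} = set a" "set b \<inter> {..n} = set b" using un by auto
    then show "ca n = length a" "cb n = length b"
      using a b by (auto simp: ca_def cb_def strict_sorted_iff distinct_card)
  qed
  have ia: "a ! i \<le> m \<longleftrightarrow> i < ca m" if "i < length a" for i m
    using nth_le_iff_less_card[OF a that] by (simp add: ca_def)
  have ib: "b ! i \<le> m \<longleftrightarrow> i < cb m" if "i < length b" for i m
    using nth_le_iff_less_card[OF b that] by (simp add: cb_def)
  have cb_le: "cb m \<le> length b" for m
    unfolding cb_def by (meson card_length card_mono finite_set inf_le1 order_trans)
  show ?thesis
  proof
    assume *: "length b \<le> length a \<and> (\<forall>j<length b. a ! j < b ! j)"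
    show "ballot n (set b)"
      unfolding ballot_def
    proof (intro allI impI)
      fix m assume m: "m \<le> n"
      have "cb m \<le> ca m"
      proof (cases "cb m")
        case (Suc k)
        then have k: "k < length b" using cb_le[of m] by simp
        then have "b ! k \<le> m" using ib[of k m] Suc by simp
        moreover have "a ! k < b ! k" using * k by blast
        ultimately have "a ! k \<le> m" by simp
        then show ?thesis using ia[of k m] * k Suc by simp
      qed simp
      then show "height (set b) m \<le> 0" using h[OF m] by simp
    qed
  next
    assume *: "ballot n (set b)"
    then have le: "cb m \<le> ca m" if "m \<le> n" for m using that h by (auto simp: ballot_def)
    have len: "length b \<le> length a" using le[of n] an bn by simp
    have "a ! j < b ! j" if j: "j < length b" for j
    proof -
      have bj: "b ! j \<in> set b" using j by simp
      have aj: "a ! j \<in> set a" using j len by simp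
      have "b ! j \<le> n" using bj un by auto
      then have "j < ca (b ! j)" using ib[OF j, of "b ! j"] le[of "b ! j"] by simp
      then have "a ! j \<le> b ! j" using ia[of j] j len by simp
      moreover have "a ! j \<noteq> b ! j" using aj bj disj by auto
      ultimately show ?thesis by simp
    qed
    then show "length b \<le> length a \<and> (\<forall>j<length b. a ! j < b ! j)" using len by simp
  qed
qed

lemma standard_two_rows_iff:
  "standard_young_tableau n [a, b] \<longleftrightarrow>
     a \<noteq> [] \<and> b \<noteq> [] \<and> sorted_wrt (<) a \<and> sorted_wrt (<) b \<and>
     set a \<inter> set b = {} \<and> set a \<union> set b = {1..n} \<and> ballot n (set b)"
proof -
  have "standard_young_tableau n [a, b] \<longleftrightarrow>
     a \<noteq> [] \<and> b \<noteq> [] \<and> sorted_wrt (<) a \<and> sorted_wrt (<) b \<and>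
     set a \<inter> set b = {} \<and> set a \<union> set b = {1..n} \<and>
     (length b \<le> length a \<and> (\<forall>j<length b. a ! j < b ! j))"
    by (auto simp: standard_young_tableau_def strict_sorted_iff)
  then show ?thesis using columns_increase_iff_ballot by metis
qed

lemma standard_one_row_iff:
  assumes "n \<ge> 1"
  shows "standard_young_tableau n [a] \<longleftrightarrow> a = [1..<Suc n]"
proof
  assume "standard_young_tableau n [a]"
  then have "sorted a" "distinct a" "set a = {1..n}"
    by (auto simp: standard_young_tableau_def strict_sorted_iff)
  moreover have "set [1..<Suc n] = {1..n}" by auto
  ultimately show "a = [1..<Suc n]"
    by (metis distinct_upt sorted_distinct_set_unique sorted_upt)
next
  assume "a = [1..<Suc n]"
  moreover have "set [1..<Suc n] = {1..n}" "[1..<Suc n] \<noteq> []" using assms by auto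
  moreover have "sorted_wrt (<) [1..<Suc n]" by (rule sorted_wrt_upt)
  ultimately show "standard_young_tableau n [a]"
    by (simp add: standard_young_tableau_def del: upt_Suc)
qed

text \<open>The first row consists of the entries that are not in the second, and each row lists its entries
  in increasing order; this gives the inverse map. The ballot condition at 1 puts 1 into the first
  row, so that no row of the constructed tableau is empty.\<close>

lemma bij_betw_second_row:
  assumes n: "n \<ge> 1"
  shows "bij_betw second_row (U n) {L. L \<subseteq> {1..n} \<and> ballot n L \<and> uncrowded (int ` L)}"
proof -
  (* A tableau consists of nonempty rows, so the empty set yields one row, not two. *)
  define tab where "tab L = (if L = {} then [[1..<Suc n]]
     else [sorted_list_of_set ({1..n} - L), sorted_list_of_set L])" for L
  have cases: "T = [[1..<Suc n]] \<or> (\<exists>a b. T = [a, b])" if T: "T \<in> U n" for T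
  proof -
    have "length T \<le> 2" "standard_young_tableau n T" using T by (auto simp: U_def)
    then consider "T = []" | a where "T = [a]" | a b where "T = [a, b]"
      by (cases T rule: remdups_adj.cases) auto
    then show ?thesis
    proof cases
      case 1
      then show ?thesis using \<open>standard_young_tableau n T\<close> n
        by (auto simp: standard_young_tableau_def)
    next
      case 2
      then show ?thesis using \<open>standard_young_tableau n T\<close> standard_one_row_iff[OF n] by auto
    qed auto
  qed
  have ballot_empty: "ballot n {}" by (simp add: ballot_def height_def)
  show ?thesis
  proof (rule bij_betw_byWitness[where f' = tab])
    show "\<forall>T\<in>U n. tab (second_row T) = T"
    proof
      fix T assume T: "T \<in> U n"
      then show "tab (second_row T) = T"
        using cases[OF T]
      proof (elim disjE exE)
        fix a b assume ab: "T = [a, b]"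
        then have s: "standard_young_tableau n [a, b]" using T by (simp add: U_def)
        then have "{1..n} - set b = set a" by (auto simp: standard_two_rows_iff)
        then show ?thesis using s ab
          by (auto simp: tab_def second_row_def standard_two_rows_iff strict_sorted_iff
              sorted_list_of_set.idem_if_sorted_distinct)
      qed (simp add: tab_def second_row_def)
    qed
    show "\<forall>L\<in>{L. L \<subseteq> {1..n} \<and> ballot n L \<and> uncrowded (int ` L)}. second_row (tab L) = L"
      by (auto simp: tab_def second_row_def finite_subset)
    show "second_row ` U n \<subseteq> {L. L \<subseteq> {1..n} \<and> ballot n L \<and> uncrowded (int ` L)}"
    proof (rule image_subsetI)
      fix T assume T: "T \<in> U n"
      show "second_row T \<in> {L. L \<subseteq> {1..n} \<and> ballot n L \<and> uncrowded (int ` L)}"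
        using cases[OF T]
      proof (elim disjE exE)
        fix a b assume "T = [a, b]"
        then show ?thesis using T by (auto simp: U_def second_row_def standard_two_rows_iff)
      next
        assume "T = [[1..<Suc n]]"
        then show ?thesis using ballot_empty by (simp add: second_row_def uncrowded_def)
      qed
    qed
    show "tab ` {L. L \<subseteq> {1..n} \<and> ballot n L \<and> uncrowded (int ` L)} \<subseteq> U n"
    proof (rule image_subsetI)
      fix L assume "L \<in> {L. L \<subseteq> {1..n} \<and> ballot n L \<and> uncrowded (int ` L)}"
      then have L: "L \<subseteq> {1..n}" "ballot n L" "uncrowded (int ` L)" by auto
      have fin: "finite L" using L(1) finite_subset by blast
      have one: "1 \<notin> L"
      proof
        assume "1 \<in> L"
        then have "height L 1 = 1" by (simp add: height_Suc)
        then show False using L(2) n by (auto simp: ballot_def)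
      qed
      have two: "standard_young_tableau n (tab L)" if "L \<noteq> {}"
      proof -
        have "1 \<in> {1..n} - L" using one n by simp
        then have "{1..n} - L \<noteq> {}" by blast
        then show ?thesis using that L fin by (auto simp: tab_def standard_two_rows_iff)
      qed
      show "tab L \<in> U n"
        using L two standard_one_row_iff[OF n] fin
        by (cases "L = {}") (auto simp: U_def tab_def second_row_def)
    qed
  qed
qed

section \<open>The walk of a second row\<close>

text \<open>The defining windows have odd length \<open>2x + 1 \<ge> 3\<close> and say that the path climbs by at most 1 over
  such a window, which by parity is the same as at most 2. A window of even length is contained in
  one that is longer by 1, which gives the bound 2 there; windows of length at most 2 satisfy it
  trivially. Conversely, the part of a window outside \<open>{1..n}\<close> contains no elements of \<open>L\<close>.\<close>

lemma uncrowded_iff_height: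
  assumes L: "L \<subseteq> {1..n}"
  shows "uncrowded (int ` L) \<longleftrightarrow> (\<forall>i j. i \<le> j \<and> j \<le> n \<longrightarrow> height L j - height L i \<le> 2)"
proof
  assume unc: "uncrowded (int ` L)"
  show "\<forall>i j. i \<le> j \<and> j \<le> n \<longrightarrow> height L j - height L i \<le> 2"
  proof (intro allI impI, elim conjE)
    fix i j :: nat assume ij: "i \<le> j" "j \<le> n"
    let ?c = "card (L \<inter> {i<..j})"
    (* The window of length 2x + 1 starting at i + 1 covers {i<..j} for either parity of j - i. *)
    define x where "x = (j - i) div 2"
    have "2 * ?c \<le> 2 + (j - i)"
    proof (cases "x = 0")
      case True
      have "?c \<le> card {i<..j}" by (rule card_mono) auto
      then show ?thesis using True by (simp add: x_def)
    next
      case False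
      let ?W = "{int i + 1..int i + 1 + 2 * int x} \<inter> int ` L"
      have "int ` (L \<inter> {i<..j}) \<subseteq> ?W" using ij by (auto simp: x_def)
      then have "card (int ` (L \<inter> {i<..j})) \<le> card ?W" by (intro card_mono) auto
      then have "?c \<le> card ?W" by (simp add: card_image)
      moreover have "int (card ?W) \<le> int x + 1"
        using unc False unfolding uncrowded_def by (metis of_nat_0_less_iff neq0_conv)
      ultimately show ?thesis unfolding x_def by linarith
    qed
    then show "height L j - height L i \<le> 2" using height_diff[OF ij(1)] by simp
  qed
next
  assume win: "\<forall>i j. i \<le> j \<and> j \<le> n \<longrightarrow> height L j - height L i \<le> 2"
  show "uncrowded (int ` L)"
    unfolding uncrowded_def
  proof (intro allI impI)
    fix x y :: int assume x: "x > 0"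
    let ?W = "{y..y + 2 * x} \<inter> int ` L"
    (* The window is cut down to the range of the entries before heights are compared. *)
    define i j where "i = nat (y - 1)" and "j = nat (min (int n) (y + 2 * x))"
    show "int (card ?W) \<le> x + 1"
    proof (cases "i \<le> j")
      case True
      have jn: "j \<le> n" by (auto simp: j_def)
      have "?W \<subseteq> int ` (L \<inter> {i<..j})"
      proof
        fix z assume "z \<in> ?W"
        then obtain l where l: "l \<in> L" "z = int l" "y \<le> int l" "int l \<le> y + 2 * x" by auto
        moreover have "1 \<le> l" "l \<le> n" using l L by auto
        ultimately have "l \<in> {i<..j}" by (auto simp: i_def j_def)
        then show "z \<in> int ` (L \<inter> {i<..j})" using l by auto
      qed
      then have "card ?W \<le> card (int ` (L \<inter> {i<..j}))" by (intro card_mono) auto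
      then have "card ?W \<le> card (L \<inter> {i<..j})" by (simp add: card_image)
      moreover have "2 * int (card (L \<inter> {i<..j})) \<le> 2 + int (j - i)"
        using win True jn height_diff[OF True, of L] by fastforce
      moreover have "int (j - i) \<le> 2 * x + 1" using x by (auto simp: i_def j_def)
      ultimately show ?thesis by linarith
    next
      case False
      have "?W = {}"
      proof (rule ccontr)
        assume "?W \<noteq> {}"
        then obtain l where l: "l \<in> L" "y \<le> int l" "int l \<le> y + 2 * x" by auto
        moreover have "1 \<le> l" "l \<le> n" using l L by auto
        ultimately show False using False by (auto simp: i_def j_def)
      qed
      then show ?thesis using x by (metis card.empty of_nat_0 add_nonneg_nonneg less_imp_le zero_le_one)
    qed
  qed
qed

text \<open>The number of consecutive up-steps that the ballot condition and the uncrowdedness still permit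
  after \<open>m\<close> steps; it becomes negative when one of them is violated.\<close>

fun room :: "nat set \<Rightarrow> nat \<Rightarrow> int" where
  "room L 0 = 0"
| "room L (Suc m) = (if Suc m \<in> L then room L m - 1 else min 2 (room L m + 1))"

text \<open>Together with \<open>room_attained\<close> this shows that the room is the minimum of the distances to the
  bounds: the height must not exceed 0, nor any earlier height by more than 2. A step changes all
  distances by the same amount; the cap at 2 comes from the new point itself, for which the
  distance is 2.\<close>

lemma room_le: "room L m \<le> - height L m" "i \<le> m \<Longrightarrow> room L m \<le> 2 - (height L m - height L i)"
proof (induction m arbitrary: i)
  case (Suc m)
  have two: "room L m \<le> 2" using Suc.IH(2)[of m] by simp
  { case 1 show ?case using Suc.IH(1) by (auto simp: height_Suc) }
  { case 2
    then consider "i = Suc m" | "i \<le> m" by linarith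
    then show ?case
    proof cases
      case 1 then show ?thesis using two by simp
    next
      case 2 then show ?thesis using Suc.IH(2)[OF 2] by (auto simp: height_Suc)
    qed }
qed auto

lemma room_attained:
  "room L m = - height L m \<or> (\<exists>i\<le>m. room L m = 2 - (height L m - height L i))"
proof (induction m)
  case (Suc m)
  show ?case
  proof (cases "Suc m \<notin> L \<and> room L m + 1 > 2")
    case True
    then have "room L (Suc m) = 2 - (height L (Suc m) - height L (Suc m))" by simp
    then show ?thesis by blast
  next
    case False
    then have r: "room L (Suc m) = room L m - (height L (Suc m) - height L m)"
      by (auto simp: height_Suc)
    show ?thesis
      using Suc.IH
    proof (elim disjE exE conjE)
      assume "room L m = - height L m"
      then show ?thesis using r by simp
    next
      fix i assume "i \<le> m" "room L m = 2 - (height L m - height L i)"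
      then have "i \<le> Suc m" "room L (Suc m) = 2 - (height L (Suc m) - height L i)" using r by auto
      then show ?thesis by blast
    qed
  qed
qed simp

lemma room_le_2: "room L m \<le> 2"
  using room_le(2)[of m m L] by simp

definition admissible :: "nat \<Rightarrow> nat set set" where
  "admissible n = {L. L \<subseteq> {1..n} \<and> (\<forall>m\<le>n. 0 \<le> room L m)}"

text \<open>All distances in the minimum that defines the room are nonnegative exactly when the room is.\<close>

lemma admissible_eq:
  "admissible n = {L. L \<subseteq> {1..n} \<and> ballot n L \<and> uncrowded (int ` L)}"
proof -
  have "(\<forall>m\<le>n. 0 \<le> room L m) \<longleftrightarrow> ballot n L \<and> uncrowded (int ` L)" if L: "L \<subseteq> {1..n}" for L
    unfolding uncrowded_iff_height[OF L] ballot_def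
  proof safe
    fix m assume *: "\<forall>m\<le>n. 0 \<le> room L m" "m \<le> n"
    then show "height L m \<le> 0" using room_le(1)[of L m] by force
  next
    fix i j assume *: "\<forall>m\<le>n. 0 \<le> room L m" "i \<le> j" "j \<le> n"
    then show "height L j - height L i \<le> 2" using room_le(2)[of i j L] by force
  next
    fix m assume "\<forall>m\<le>n. height L m \<le> 0" "m \<le> n"
      "\<forall>i j. i \<le> j \<and> j \<le> n \<longrightarrow> height L j - height L i \<le> 2"
    then show "0 \<le> room L m" using room_attained[of L m] by force
  qed
  then show ?thesis unfolding admissible_def by blast
qed

lemma card_split:
  assumes "finite A"
  shows "card A = card {x \<in> A. \<not> P x} + card {x \<in> A. P x}"
proof -
  have "A = {x \<in> A. \<not> P x} \<union> {x \<in> A. P x}" by auto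
  then show ?thesis
    using assms card_Un_disjoint[of "{x \<in> A. \<not> P x}" "{x \<in> A. P x}"] by fastforce
qed

lemma finite_admissible: "finite (admissible n)"
  by (rule finite_subset[of _ "Pow {1..n}"]) (auto simp: admissible_def)

lemma room_insert_later: "m < k \<Longrightarrow> room (insert k L) m = room L m"
  by (induction m) auto

lemma Suc_notin_admissible: "L \<in> admissible n \<Longrightarrow> Suc n \<notin> L"
  by (auto simp: admissible_def)

text \<open>A down-step never violates a condition.\<close>

lemma admissible_without_last: "{L \<in> admissible (Suc n). Suc n \<notin> L} = admissible n"
proof -
  have "L \<subseteq> {1..n}" if "L \<subseteq> {1..Suc n}" "Suc n \<notin> L" for L
    using that by (force simp: le_Suc_eq)
  then show ?thesis by (fastforce simp: admissible_def le_Suc_eq)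
qed

lemma admissible_with_last:
  "{L \<in> admissible (Suc n). Suc n \<in> L} = insert (Suc n) ` {L \<in> admissible n. 1 \<le> room L n}"
proof (intro equalityI subsetI)
  fix L assume "L \<in> {L \<in> admissible (Suc n). Suc n \<in> L}"
  then have L: "L \<subseteq> {1..Suc n}" "\<forall>m\<le>Suc n. 0 \<le> room L m" "Suc n \<in> L"
    by (auto simp: admissible_def)
  let ?K = "L - {Suc n}"
  have LK: "L = insert (Suc n) ?K" using L(3) by auto
  then have r: "room L m = room ?K m" if "m \<le> n" for m
    using that room_insert_later[of m "Suc n" ?K] by simp
  have "0 \<le> room L (Suc n)" using L(2) by blast
  then have "1 \<le> room ?K n" using L(3) r by simp
  moreover have "?K \<subseteq> {1..n}" using L(1) by (force simp: le_Suc_eq)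
  ultimately have "?K \<in> {L \<in> admissible n. 1 \<le> room L n}"
    using L(2) r by (simp add: admissible_def) (metis le_SucI)
  then show "L \<in> insert (Suc n) ` {L \<in> admissible n. 1 \<le> room L n}" using LK by blast
next
  fix L assume "L \<in> insert (Suc n) ` {L \<in> admissible n. 1 \<le> room L n}"
  then obtain K where K: "K \<in> admissible n" "1 \<le> room K n" "L = insert (Suc n) K" by blast
  then have r: "room L m = room K m" if "m \<le> n" for m
    using that room_insert_later[of m "Suc n" K] by simp
  show "L \<in> {L \<in> admissible (Suc n). Suc n \<in> L}"
    using K r by (auto simp: admissible_def le_Suc_eq)
qed

section \<open>Counting walks by their final state\<close>

definition ends :: "nat \<Rightarrow> int \<Rightarrow> nat" where
  "ends n r = card {L \<in> admissible n. room L n = r}"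

lemma card_with_last:
  assumes "P \<subseteq> admissible n"
  shows "card (insert (Suc n) ` P) = card P"
proof (rule card_image, rule inj_onI)
  fix K L assume "K \<in> P" "L \<in> P" "insert (Suc n) K = insert (Suc n) L"
  then show "K = L" using assms Suc_notin_admissible by (metis insert_ident subsetD)
qed

lemma ends_Suc:
  assumes "0 \<le> r"
  shows "ends (Suc n) r = card {L \<in> admissible n. min 2 (room L n + 1) = r} + ends n (r + 1)"
proof -
  let ?A = "{L \<in> admissible (Suc n). room L (Suc n) = r}"
  let ?N = "{L \<in> admissible n. min 2 (room L n + 1) = r}"
  let ?I = "{L \<in> admissible n. room L n = r + 1}"
  have "{L \<in> ?A. Suc n \<notin> L} = {L \<in> {L \<in> admissible (Suc n). Suc n \<notin> L}. room L (Suc n) = r}"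
    by auto
  also have "\<dots> = ?N"
    unfolding admissible_without_last using Suc_notin_admissible by auto
  finally have N: "{L \<in> ?A. Suc n \<notin> L} = ?N" .
  have "{L \<in> ?A. Suc n \<in> L} = {L \<in> {L \<in> admissible (Suc n). Suc n \<in> L}. room L (Suc n) = r}"
    by auto
  also have "\<dots> = insert (Suc n) ` ?I"
    unfolding admissible_with_last using assms room_insert_later[of n "Suc n"]
    by (auto intro!: imageI)
  finally have I: "{L \<in> ?A. Suc n \<in> L} = insert (Suc n) ` ?I" .
  have "card ?A = card {L \<in> ?A. Suc n \<notin> L} + card {L \<in> ?A. Suc n \<in> L}"
    by (rule card_split) (simp add: finite_admissible)
  then show ?thesis
    unfolding N I using card_with_last[of ?I n] by (simp add: ends_def)
qed

lemma room_cases: "L \<in> admissible n \<Longrightarrow> room L n = 0 \<or> room L n = 1 \<or> room L n = 2"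
  using room_le_2[of L n] by (force simp: admissible_def)

lemma ends_Suc_states:
  "ends (Suc n) 0 = ends n 1"
  "ends (Suc n) 1 = ends n 0 + ends n 2"
  "ends (Suc n) 2 = ends n 1 + ends n 2"
proof -
  have none: "{L \<in> admissible n. min 2 (room L n + 1) = 0} = {}"
    using room_cases by fastforce
  show "ends (Suc n) 0 = ends n 1" by (simp add: ends_Suc none del: Collect_empty_eq)
  have "{L \<in> admissible n. min 2 (room L n + 1) = 1} = {L \<in> admissible n. room L n = 0}"
    by auto
  then show "ends (Suc n) 1 = ends n 0 + ends n 2" using ends_Suc[of 1 n] by (simp add: ends_def)
  have "{L \<in> admissible n. min 2 (room L n + 1) = 2}
      = {L \<in> admissible n. room L n = 1} \<union> {L \<in> admissible n. room L n = 2}"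
    using room_cases by fastforce
  moreover have "card \<dots> = ends n 1 + ends n 2"
    unfolding ends_def using finite_admissible by (subst card_Un_disjoint) auto
  moreover have "ends n 3 = 0"
  proof -
    have "{L \<in> admissible n. room L n = 3} = {}" using room_cases by fastforce
    then show ?thesis unfolding ends_def by (simp only: card.empty)
  qed
  ultimately show "ends (Suc n) 2 = ends n 1 + ends n 2" by (simp add: ends_Suc)
qed

text \<open>With \<open>A006053\<close> as the count of state 2, the other closed forms are forced: state 2 at \<open>n + 1\<close>
  fixes state 1 at \<open>n\<close>, and state 1 at \<open>n + 1\<close> then fixes state 0 at \<open>n\<close>. The recurrence of
  state 0 becomes the recurrence of \<open>A006053\<close>.\<close>

lemma ends_eq_A006053:
  "int (ends n 2) = A006053 n \<and>
   int (ends n 1) = A006053 (Suc n) - A006053 n \<and>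
   int (ends n 0) = A006053 (Suc (Suc n)) - A006053 (Suc n) - A006053 n"
proof (induction n)
  case 0
  have "admissible 0 = {{}}" by (auto simp: admissible_def)
  then have "{L \<in> admissible 0. room L 0 = r} = (if r = 0 then {{}} else {})" for r by auto
  then have "ends 0 r = (if r = 0 then 1 else 0)" for r by (simp add: ends_def)
  then show ?case by simp
next
  case (Suc n)
  then show ?case by (simp add: ends_Suc_states)
qed

text \<open>A final up-step needs positive room before it, so these sets correspond to the walks that are one
  step shorter and end in the states 1 and 2.\<close>

lemma card_admissible_with_last:
  "int (card {L \<in> admissible (Suc n). Suc n \<in> L}) = A006053 (Suc n)"
proof -
  have "{L \<in> admissible n. 1 \<le> room L n}
      = {L \<in> admissible n. room L n = 1} \<union> {L \<in> admissible n. room L n = 2}"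
    using room_cases by fastforce
  then have "card {L \<in> admissible n. 1 \<le> room L n} = ends n 1 + ends n 2"
    unfolding ends_def using finite_admissible by (simp add: card_Un_disjoint disjoint_iff)
  then show ?thesis
    unfolding admissible_with_last using card_with_last[of "{L \<in> admissible n. 1 \<le> room L n}" n]
      ends_eq_A006053[of n] by simp
qed

lemma A028495_Suc: "A028495 (Suc n) = A028495 n + A006053 (Suc n)"
  by (induction n rule: A028495.induct) auto

lemma card_admissible: "int (card (admissible n)) = A028495 n"
proof (induction n)
  case 0
  have "admissible 0 = {{}}" by (auto simp: admissible_def)
  then show ?case by simp
next
  case (Suc n)
  let ?A = "admissible (Suc n)"
  have "card ?A = card {L \<in> ?A. Suc n \<notin> L} + card {L \<in> ?A. Suc n \<in> L}"
    by (rule card_split) (rule finite_admissible)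
  then show ?case
    unfolding admissible_without_last
    using Suc card_admissible_with_last[of n] A028495_Suc[of n] by simp
qed

section \<open>Words with odd blocks of ones\<close>

text \<open>The three rules for \<open>0w\<close>, \<open>10w\<close> and \<open>11w\<close> reduce the condition on blocks to shorter words. In the first
  two, the 0 separates the blocks of \<open>w\<close> from the letters before it, and the single 1 of \<open>10w\<close> is a
  block of odd length.\<close>

lemma odd_one_blocks_0: "odd_one_blocks (0 # w) \<longleftrightarrow> odd_one_blocks w"
proof
  assume *: "odd_one_blocks (0 # w)"
  show "odd_one_blocks w"
    unfolding odd_one_blocks_def
  proof (intro allI impI, elim conjE)
    fix u k v assume h: "w = u @ replicate k 1 @ v" "k > 0" "u = [] \<or> last u \<noteq> (1::nat)" "v = [] \<or> hd v \<noteq> 1"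
    then have "0 # w = (0 # u) @ replicate k 1 @ v" "last (0 # u) \<noteq> 1" by auto
    then show "odd k" using * h unfolding odd_one_blocks_def by blast
  qed
next
  assume *: "odd_one_blocks w"
  show "odd_one_blocks (0 # w)"
    unfolding odd_one_blocks_def
  proof (intro allI impI, elim conjE)
    fix u k v assume h: "0 # w = u @ replicate k 1 @ v" "k > 0" "u = [] \<or> last u \<noteq> (1::nat)" "v = [] \<or> hd v \<noteq> 1"
    then obtain u' where u: "u = 0 # u'" by (cases u; cases k) auto
    then have "w = u' @ replicate k 1 @ v" "u' = [] \<or> last u' \<noteq> 1" using h by (auto split: if_splits)
    then show "odd k" using * h unfolding odd_one_blocks_def by blast
  qed
qed

lemma odd_one_blocks_10: "odd_one_blocks (1 # 0 # w) \<longleftrightarrow> odd_one_blocks w"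
proof
  assume *: "odd_one_blocks (1 # 0 # w)"
  show "odd_one_blocks w"
    unfolding odd_one_blocks_def
  proof (intro allI impI, elim conjE)
    fix u k v assume h: "w = u @ replicate k 1 @ v" "k > 0" "u = [] \<or> last u \<noteq> (1::nat)" "v = [] \<or> hd v \<noteq> 1"
    then have "1 # 0 # w = (1 # 0 # u) @ replicate k 1 @ v" "last (1 # 0 # u) \<noteq> 1" by auto
    then show "odd k" using * h unfolding odd_one_blocks_def by blast
  qed
next
  assume *: "odd_one_blocks w"
  show "odd_one_blocks (1 # 0 # w)"
    unfolding odd_one_blocks_def
  proof (intro allI impI, elim conjE)
    fix u k v assume h: "1 # 0 # w = u @ replicate k 1 @ v" "k > 0" "u = [] \<or> last u \<noteq> (1::nat)" "v = [] \<or> hd v \<noteq> 1"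
    show "odd k"
    proof (cases u)
      case Nil
      then have "k = 1" using h by (cases k; cases "k - 1") auto
      then show ?thesis by simp
    next
      case (Cons a u')
      then obtain u'' where u: "u = 1 # 0 # u''" using h by (cases u'; cases k) auto
      then have "w = u'' @ replicate k 1 @ v" "u'' = [] \<or> last u'' \<noteq> 1" using h by (auto split: if_splits)
      then show "odd k" using * h unfolding odd_one_blocks_def by blast
    qed
  qed
qed

text \<open>If \<open>w\<close> begins with 1, the two additional letters lengthen its first block by 2 and preserve its
  parity; otherwise they form a block of length 2.\<close>

lemma odd_one_blocks_11:
  "odd_one_blocks (1 # 1 # w) \<longleftrightarrow> odd_one_blocks w \<and> w \<noteq> [] \<and> hd w = 1"
proof
  assume *: "odd_one_blocks (1 # 1 # w)"
  have "w \<noteq> [] \<and> hd w = 1"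
  proof (rule ccontr)
    assume "\<not> (w \<noteq> [] \<and> hd w = 1)"
    moreover have "1 # 1 # w = [] @ replicate 2 1 @ w" by (simp add: numeral_2_eq_2)
    ultimately have "odd (2::nat)" using * unfolding odd_one_blocks_def by (metis pos2)
    then show False by simp
  qed
  moreover have "odd_one_blocks w"
    unfolding odd_one_blocks_def
  proof (intro allI impI, elim conjE)
    fix u k v assume h: "w = u @ replicate k 1 @ v" "k > 0" "u = [] \<or> last u \<noteq> (1::nat)" "v = [] \<or> hd v \<noteq> 1"
    show "odd k"
    proof (cases "u = []")
      case True
      then have "1 # 1 # w = [] @ replicate (Suc (Suc k)) 1 @ v" using h by simp
      then have "odd (Suc (Suc k))" using * h(4) unfolding odd_one_blocks_def by blast
      then show ?thesis by simp
    next
      case False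
      then have "1 # 1 # w = (1 # 1 # u) @ replicate k 1 @ v" "last (1 # 1 # u) \<noteq> 1" using h by auto
      then show "odd k" using * h unfolding odd_one_blocks_def by blast
    qed
  qed
  ultimately show "odd_one_blocks w \<and> w \<noteq> [] \<and> hd w = 1" by blast
next
  assume *: "odd_one_blocks w \<and> w \<noteq> [] \<and> hd w = 1"
  show "odd_one_blocks (1 # 1 # w)"
    unfolding odd_one_blocks_def
  proof (intro allI impI, elim conjE)
    fix u k v assume h: "1 # 1 # w = u @ replicate k 1 @ v" "k > 0" "u = [] \<or> last u \<noteq> (1::nat)" "v = [] \<or> hd v \<noteq> 1"
    show "odd k"
    proof (cases "u = []")
      case True
      then obtain j where j: "k = Suc (Suc j)" using h by (cases k; cases "k - 1") auto
      then have w: "w = [] @ replicate j 1 @ v" using h True by simp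
      then have "j > 0" using * h(4) by (cases j) auto
      then have "odd j" using * w h(4) unfolding odd_one_blocks_def by blast
      then show ?thesis using j by simp
    next
      case False
      then obtain a u' where a: "u = a # u'" by (cases u) auto
      then have "u' \<noteq> []" using h by auto
      then obtain u'' where u: "u = 1 # 1 # u''" using h a by (cases u') auto
      then have "w = u'' @ replicate k 1 @ v" "u'' = [] \<or> last u'' \<noteq> 1" using h by (auto split: if_splits)
      then show "odd k" using * h unfolding odd_one_blocks_def by blast
    qed
  qed
qed

lemma odd_one_blocks_Nil: "odd_one_blocks []"
  by (auto simp: odd_one_blocks_def)

lemma odd_one_blocks_1: "odd_one_blocks [1]"
proof -
  have "k = 1" if "[1] = u @ replicate k (1::nat) @ v" "k > 0" for u k v
    using arg_cong[OF that(1), of length] that(2) 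
    by (simp only: length_append length_replicate list.size)
  then show ?thesis unfolding odd_one_blocks_def by (metis odd_one)
qed

lemma finite_X: "finite (X n)"
  by (rule finite_subset[OF _ finite_lists_length_eq[of "{0, 1}" "n - 1"]]) (auto simp: X_def)

definition words_from_1 :: "nat \<Rightarrow> nat list set" where
  "words_from_1 n = {w \<in> X n. w \<noteq> [] \<and> hd w = 1}"

lemma X_Suc_Suc: "X (Suc (Suc n)) = (#) 0 ` X (Suc n) \<union> words_from_1 (Suc (Suc n))"
proof (intro equalityI subsetI)
  fix w assume w: "w \<in> X (Suc (Suc n))"
  then show "w \<in> (#) 0 ` X (Suc n) \<union> words_from_1 (Suc (Suc n))"
    by (cases w) (auto simp: X_def words_from_1_def odd_one_blocks_0)
qed (auto simp: X_def words_from_1_def odd_one_blocks_0)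

lemma words_from_1_step:
  "words_from_1 (Suc (Suc (Suc n))) =
     (\<lambda>w. 1 # 0 # w) ` X (Suc n) \<union> (\<lambda>w. 1 # 1 # w) ` words_from_1 (Suc n)"
proof (intro equalityI subsetI)
  fix w assume w: "w \<in> words_from_1 (Suc (Suc (Suc n)))"
  then obtain b v where "w = 1 # b # v"
    by (cases w; cases "tl w") (auto simp: X_def words_from_1_def)
  then show "w \<in> (\<lambda>w. 1 # 0 # w) ` X (Suc n) \<union> (\<lambda>w. 1 # 1 # w) ` words_from_1 (Suc n)"
    using w odd_one_blocks_10[of v] odd_one_blocks_11[of v] by (auto simp: X_def words_from_1_def)
qed (use odd_one_blocks_10 odd_one_blocks_11 in \<open>auto simp: X_def words_from_1_def\<close>)

lemma finite_words_from_1: "finite (words_from_1 n)"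
  using finite_X by (simp add: words_from_1_def)

lemma card_X_Suc_Suc: "card (X (Suc (Suc n))) = card (X (Suc n)) + card (words_from_1 (Suc (Suc n)))"
proof -
  have "card ((#) (0::nat) ` X (Suc n)) = card (X (Suc n))" by (intro card_image inj_onI) auto
  moreover have "(#) 0 ` X (Suc n) \<inter> words_from_1 (Suc (Suc n)) = {}" by (auto simp: words_from_1_def)
  ultimately show ?thesis
    unfolding X_Suc_Suc using finite_X finite_words_from_1 by (simp add: card_Un_disjoint)
qed

lemma card_words_from_1_step:
  "card (words_from_1 (Suc (Suc (Suc n)))) = card (X (Suc n)) + card (words_from_1 (Suc n))"
proof -
  have "card ((\<lambda>w. 1 # 0 # w) ` X (Suc n)) = card (X (Suc n))"
    "card ((\<lambda>w. 1 # 1 # w) ` words_from_1 (Suc n)) = card (words_from_1 (Suc n))"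
    by (intro card_image inj_onI; simp)+
  moreover have "(\<lambda>w. 1 # 0 # w) ` X (Suc n) \<inter> (\<lambda>w. 1 # 1 # w) ` words_from_1 (Suc n) = {}" by auto
  ultimately show ?thesis
    unfolding words_from_1_step using finite_X finite_words_from_1 by (simp add: card_Un_disjoint)
qed

lemma A006053_eq: "A006053 (Suc (Suc n)) = A028495 n + A006053 n"
  by (induction n rule: A028495.induct) auto

lemma card_words:
  "int (card (words_from_1 (Suc n))) = A006053 (Suc n) \<and> int (card (X (Suc n))) = A028495 (Suc n)"
proof (induction n rule: less_induct)
  case (less n)
  have Xone: "X (Suc 0) = {[]}" using odd_one_blocks_Nil by (auto simp: X_def)
  then have empty1: "words_from_1 (Suc 0) = {}" by (auto simp: words_from_1_def)
  have "words_from_1 (Suc (Suc 0)) = {[1]}"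
    using odd_one_blocks_1 by (auto simp: words_from_1_def X_def length_Suc_conv)
  then have two1: "card (words_from_1 (Suc (Suc 0))) = 1" by simp
  show ?case
  proof (cases n)
    case 0
    then show ?thesis using Xone empty1 by simp
  next
    case (Suc m)
    have c: "int (card (words_from_1 (Suc (Suc m)))) = A006053 (Suc (Suc m))"
    proof (cases m)
      case 0
      then show ?thesis using two1 by simp
    next
      case (Suc k)
      then show ?thesis
        using less.IH[of k] \<open>n = Suc m\<close> card_words_from_1_step[of k] A006053_eq[of "Suc k"]
        by (simp del: A006053.simps)
    qed
    moreover have "int (card (X (Suc (Suc m)))) = A028495 (Suc (Suc m))"
      using c less.IH[of m] Suc card_X_Suc_Suc[of m] A028495_Suc[of "Suc m"]
      by (simp del: A006053.simps A028495.simps)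
    ultimately show ?thesis using Suc by simp
  qed
qed

lemma zeros_in_X: "replicate (n - 1) 0 \<in> X n"
proof -
  have "odd_one_blocks (replicate k 0)" for k
    by (induction k) (simp_all add: odd_one_blocks_0 odd_one_blocks_Nil)
  then show ?thesis by (auto simp: X_def)
qed

section \<open>The generating function and the conclusion\<close>

text \<open>The right-hand side is the coefficient sequence of a power series whose product with the
  denominator is 1; from the fourth coefficient on this is the difference of two consecutive
  instances of the recurrence of \<open>A028495\<close>, and the factor \<open>1 - x\<close> annihilates the constant 1.\<close>

lemma A077865_eq: "A077865 m = of_int (A028495 (m + 2)) - 1"
proof -
  let ?D = "(1 - fps_X) * (1 - fps_X - 2 * fps_X ^ 2 + fps_X ^ 3) :: rat fps"
  define f :: "rat fps" where "f = Abs_fps (\<lambda>m. of_int (A028495 (m + 2)) - 1)"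
  have D: "?D = 1 - 2 * fps_X - fps_X ^ 2 + 3 * fps_X ^ 3 - fps_X ^ 4"
    by (simp add: algebra_simps power2_eq_square power3_eq_cube power4_eq_xxxx)
  have "f * ?D = 1"
  proof (rule fps_ext)
    fix k
    have e: "f * ?D = f - fps_const 2 * (fps_X ^ 1 * f) - fps_X ^ 2 * f
        + fps_const 3 * (fps_X ^ 3 * f) - fps_X ^ 4 * f"
      unfolding D by (simp add: algebra_simps numeral_fps_const)
    consider "k = 0" | "k = 1" | "k = 2" | "k = 3" | j where "k = Suc (Suc (Suc (Suc j)))"
      by (metis One_nat_def Suc_1 eval_nat_numeral(3) not0_implies_Suc)
    then show "fps_nth (f * ?D) k = fps_nth 1 k"
      unfolding e fps_add_nth fps_sub_nth fps_mult_left_const_nth fps_X_power_mult_nth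
      by cases (simp_all add: f_def eval_nat_numeral)
  qed
  moreover have "fps_nth ?D 0 \<noteq> 0" by simp
  then have "?D \<noteq> 0" by (metis fps_zero_nth)
  ultimately have "1 / ?D = f" by (metis nonzero_mult_div_cancel_right)
  then show ?thesis by (simp add: A077865_def f_def)
qed

lemma card_U_second_row:
  assumes "n \<ge> 1"
  shows "card {T \<in> U n. P (second_row T)} = card {L \<in> admissible n. P L}"
proof (rule bij_betw_same_card)
  have b: "bij_betw second_row (U n) (admissible n)"
    using bij_betw_second_row[OF assms] by (simp add: admissible_eq)
  have "second_row ` {T \<in> U n. P (second_row T)} = {L \<in> admissible n. P L}"
    unfolding bij_betw_imp_surj_on[OF b, symmetric] by auto
  then show "bij_betw second_row {T \<in> U n. P (second_row T)} {L \<in> admissible n. P L}"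
    by (intro bij_betw_subset[OF b]) auto
qed

theorem corollary6p5:
  "((\<forall>n\<ge>1. int (card (U n)) = A028495 n \<and> A028495 n = int (card (X n))) \<and>
    map (\<lambda>n. card (U n)) [1..<11] = [1, 2, 3, 6, 10, 19, 33, 61, 108, 197]) \<and>
   (\<forall>n\<ge>2.
      int (card {T \<in> U n. length T = 2}) = int (card (U n)) - 1 \<and>
      rat_of_nat (card {T \<in> U n. length T = 2}) = A077865 (n - 2) \<and>
      card {T \<in> U n. length T = 2} = card {w \<in> X n. w \<noteq> replicate (n - 1) 0}) \<and>
   ((\<forall>n\<ge>1.
      int (card {T \<in> U n. n \<in> second_row T}) = A006053 n \<and>
      A006053 n = int (card {w \<in> X n. w \<noteq> [] \<and> hd w = 1})) \<and>
    map (\<lambda>n. card {T \<in> U n. n \<in> second_row T}) [1..<11]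
      = [0, 1, 1, 3, 4, 9, 14, 28, 47, 89])"
proof -
  have U: "int (card (U n)) = A028495 n" if "n \<ge> 1" for n
    using card_U_second_row[OF that, of "\<lambda>_. True"] card_admissible[of n] by simp
  have X: "int (card (X n)) = A028495 n" if "n \<ge> 1" for n
    using card_words[of "n - 1"] that by simp
  have Ulast: "int (card {T \<in> U n. n \<in> second_row T}) = A006053 n" if "n \<ge> 1" for n
    using card_U_second_row[OF that, of "\<lambda>L. n \<in> L"] card_admissible_with_last[of "n - 1"] that
    by simp
  have Xhd: "int (card {w \<in> X n. w \<noteq> [] \<and> hd w = 1}) = A006053 n" if "n \<ge> 1" for n
    using card_words[of "n - 1"] that by (simp add: words_from_1_def)
  have two: "int (card {T \<in> U n. length T = 2}) = A028495 n - 1" if "n \<ge> 1" for n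
  proof -
    have "second_row T \<noteq> {} \<longleftrightarrow> length T = 2" if T: "T \<in> U n" for T
    proof
      assume "length T = 2"
      then have "T ! 1 \<in> set T" by simp
      then have "T ! 1 \<noteq> []" using T by (auto simp: U_def standard_young_tableau_def)
      then show "second_row T \<noteq> {}" using \<open>length T = 2\<close> by (simp add: second_row_def)
    qed (use T in \<open>auto simp: U_def second_row_def split: if_splits\<close>)
    then have "{T \<in> U n. length T = 2} = {T \<in> U n. second_row T \<noteq> {}}" by blast
    then have "card {T \<in> U n. length T = 2} = card {L \<in> admissible n. L \<noteq> {}}"
      using card_U_second_row[OF that, of "\<lambda>L. L \<noteq> {}"] by simp
    also have "{L \<in> admissible n. L \<noteq> {}} = admissible n - {{}}" by auto
    finally have "card {T \<in> U n. length T = 2} = card (admissible n - {{}})" .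
    moreover have "{} \<in> admissible n"
      by (simp add: admissible_eq ballot_def height_def uncrowded_def)
    then have "card (admissible n) = Suc (card (admissible n - {{}}))"
      by (rule card.remove[OF finite_admissible])
    ultimately show ?thesis using card_admissible[of n] by linarith
  qed
  have Xnz: "int (card {w \<in> X n. w \<noteq> replicate (n - 1) 0}) = A028495 n - 1" if "n \<ge> 1" for n
  proof -
    have "{w \<in> X n. w \<noteq> replicate (n - 1) 0} = X n - {replicate (n - 1) 0}" by auto
    moreover have "card (X n) = Suc (card (X n - {replicate (n - 1) 0}))"
      by (rule card.remove[OF finite_X zeros_in_X])
    ultimately show ?thesis using X[OF that] by simp
  qed
  have b: "rat_of_nat (card {T \<in> U n. length T = 2}) = A077865 (n - 2)" if "n \<ge> 2" for n
  proof -
    have "rat_of_nat (card {T \<in> U n. length T = 2})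
        = of_int (int (card {T \<in> U n. length T = 2}))" by simp
    also have "\<dots> = A077865 (n - 2)"
      using two[of n] that le_add_diff_inverse2[OF that] by (simp only: A077865_eq)
    finally show ?thesis .
  qed
  have val: "card (U n) = nat (A028495 n)" "card {T \<in> U n. n \<in> second_row T} = nat (A006053 n)"
    if "n \<ge> 1" for n
    using U[OF that] Ulast[OF that] by simp_all
  have vals: "map (\<lambda>n. nat (A028495 n)) [1..<11] = [1, 2, 3, 6, 10, 19, 33, 61, 108, 197]"
    "map (\<lambda>n. nat (A006053 n)) [1..<11] = [0, 1, 1, 3, 4, 9, 14, 28, 47, 89]"
    by (simp_all add: upt_rec eval_nat_numeral)
  have Uvals: "map (\<lambda>n. card (U n)) [1..<11] = [1, 2, 3, 6, 10, 19, 33, 61, 108, 197]"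
    unfolding vals(1)[symmetric] by (rule map_cong[OF refl], rule val(1)) simp
  have Ulast_vals: "map (\<lambda>n. card {T \<in> U n. n \<in> second_row T}) [1..<11]
      = [0, 1, 1, 3, 4, 9, 14, 28, 47, 89]"
    unfolding vals(2)[symmetric] by (rule map_cong[OF refl], rule val(2)) simp
  have c: "card {T \<in> U n. length T = 2} = card {w \<in> X n. w \<noteq> replicate (n - 1) 0}" if "n \<ge> 2" for n
    using two[of n] Xnz[of n] that by linarith
  have d: "int (card {T \<in> U n. length T = 2}) = int (card (U n)) - 1" if "n \<ge> 2" for n
    using U[of n] two[of n] that by linarith
  have "\<forall>n\<ge>1. int (card (U n)) = A028495 n \<and> A028495 n = int (card (X n))"
    by (intro allI impI conjI) (simp_all only: U X)
  moreover have "\<forall>n\<ge>2.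
      int (card {T \<in> U n. length T = 2}) = int (card (U n)) - 1 \<and>
      rat_of_nat (card {T \<in> U n. length T = 2}) = A077865 (n - 2) \<and>
      card {T \<in> U n. length T = 2} = card {w \<in> X n. w \<noteq> replicate (n - 1) 0}"
    by (intro allI impI conjI) (erule d, erule b, erule c)
  moreover have "\<forall>n\<ge>1.
      int (card {T \<in> U n. n \<in> second_row T}) = A006053 n \<and>
      A006053 n = int (card {w \<in> X n. w \<noteq> [] \<and> hd w = 1})"
    by (intro allI impI conjI) (simp_all only: Ulast Xhd)
  ultimately show ?thesis using Uvals Ulast_vals by (intro conjI)
qed

end
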